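(* Let $m\ge 2$ and let $a\in\mathcal O_m$ be any associative binary operation on $I=\{1,\dots,m\}$. Then the algebra $\mathfrak C_a$ of cubic matrices over $\mathbb R$ is not baric; that is, there is no nonzero algebra homomorphism $\chi\colon\mathfrak C_a\to\mathbb R$.
   Context: $\mathcal O_m$ denotes the set of all associative binary operations $a\colon I\times I\to I$. $\mathfrak C$ is the $m^3$-dimensional $\mathbb R$-vector space of cubic matrices $A=(a_{ijk})_{i,j,k=1}^m$ with real entries (entrywise addition and scalar multiplication), with standard basis $E_{ijk}$, $i,j,k\in I$ (the $(i,j,k)$ entry of $E_{ijk}$ is $1$ and all others are $0$). For $a\in\mathcal O_m$, the multiplication $*_a$ on $\mathfrak C$ is the bilinear extension of $$E_{ijk}*_aE_{lnr}=\delta_{kl}\,E_{i\,a(j,n)\,r},$$ where $\delta_{kl}$ is the Kronecker symbol, and $\mathfrak C_a=(\mathfrak C,*_a)$. Algebra homomorphisms are linear multiplicative maps (no unit is required to be preserved). A character of an algebra $\mathcal A$ is a nonzero algebra homomorphism $\chi\colon\mathcal A\to\mathbb R$ (a nonzero multiplicative linear form); an algebra is baric if it admits a character. *)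

theory Defs
  imports "HOL-Analysis.Analysis"
begin

text \<open>
  The index set \<open>I = {1, ..., m}\<close> is rendered as a finite type \<open>'m\<close> with \<open>CARD('m) = m\<close>.
  The \<open>(i, j, k)\<close> entry of a cubic matrix \<open>A\<close> is \<open>A $ i $ j $ k\<close>, and the vector space
  structure is the entrywise one of the library.
\<close>

type_synonym 'm cubic_matrix = "real ^ 'm ^ 'm ^ 'm"

definition cubic_unit :: "'m::finite \<Rightarrow> 'm \<Rightarrow> 'm \<Rightarrow> 'm cubic_matrix" where
  "cubic_unit i j k = (\<chi> i' j' k'. if i' = i \<and> j' = j \<and> k' = k then 1 else 0)"

text \<open>
  The bilinear extension of \<open>E\<^sub>i\<^sub>j\<^sub>k * E\<^sub>l\<^sub>n\<^sub>r = \<delta>\<^sub>k\<^sub>l E\<^sub>i\<^sub>a\<^sub>(\<^sub>j\<^sub>,\<^sub>n\<^sub>)\<^sub>r\<close>, written out on the coordinates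
  of \<open>A = \<Sum> A\<^sub>i\<^sub>j\<^sub>k E\<^sub>i\<^sub>j\<^sub>k\<close> and \<open>B = \<Sum> B\<^sub>l\<^sub>n\<^sub>r E\<^sub>l\<^sub>n\<^sub>r\<close>. That this is the (unique) bilinear map
  with the stated values on the basis is \<open>bilinear_cubic_mult\<close>, \<open>cubic_mult_unit\<close> and
  \<open>cubic_mult_unique\<close> below.
\<close>

definition cubic_mult ::
    "('m \<Rightarrow> 'm \<Rightarrow> 'm) \<Rightarrow> 'm::finite cubic_matrix \<Rightarrow> 'm cubic_matrix \<Rightarrow> 'm cubic_matrix" where
  "cubic_mult a A B =
     (\<Sum>i\<in>UNIV. \<Sum>j\<in>UNIV. \<Sum>k\<in>UNIV. \<Sum>l\<in>UNIV. \<Sum>n\<in>UNIV. \<Sum>r\<in>UNIV.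
        (A $ i $ j $ k * B $ l $ n $ r) *\<^sub>R (if k = l then cubic_unit i (a j n) r else 0))"

text \<open>
  A (not necessarily associative or unital) real algebra is given by its multiplication on a type
  of class \<open>real_vector\<close>; one vector space can thus carry several algebra structures.
\<close>

definition algebra_hom ::
    "('u::real_vector \<Rightarrow> 'u \<Rightarrow> 'u) \<Rightarrow> ('v::real_vector \<Rightarrow> 'v \<Rightarrow> 'v) \<Rightarrow> ('u \<Rightarrow> 'v) \<Rightarrow> bool" where
  "algebra_hom mul mul' f \<longleftrightarrow> linear f \<and> (\<forall>x y. f (mul x y) = mul' (f x) (f y))"

definition algebra_character :: "('u::real_vector \<Rightarrow> 'u \<Rightarrow> 'u) \<Rightarrow> ('u \<Rightarrow> real) \<Rightarrow> bool" where
  "algebra_character mul f \<longleftrightarrow> algebra_hom mul (*) f \<and> f \<noteq> (\<lambda>x. 0)"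

definition baric :: "('u::real_vector \<Rightarrow> 'u \<Rightarrow> 'u) \<Rightarrow> bool" where
  "baric mul \<longleftrightarrow> (\<exists>f. algebra_character mul f)"

lemma cubic_unit_nth:
  "cubic_unit i j k $ i' $ j' $ k' = (if i' = i \<and> j' = j \<and> k' = k then 1 else 0)"
  by (simp add: cubic_unit_def)

lemma sum_cubic_unit_scaleR:
  fixes h :: "'m::finite \<Rightarrow> 'm \<Rightarrow> 'm \<Rightarrow> 'v::real_vector"
  shows "(\<Sum>i\<in>UNIV. \<Sum>j\<in>UNIV. \<Sum>k\<in>UNIV. cubic_unit p q s $ i $ j $ k *\<^sub>R h i j k) = h p q s"
proof -
  have pull: "(\<Sum>j\<in>UNIV. if P then f j else 0) = (if P then \<Sum>j\<in>UNIV. f j else 0)"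
    for P and f :: "'m \<Rightarrow> 'v"
    by simp
  have "cubic_unit p q s $ i $ j $ k *\<^sub>R h i j k =
      (if i = p then if j = q then if k = s then h i j k else 0 else 0 else 0)" for i j k
    by (simp add: cubic_unit_nth)
  then show ?thesis
    by (simp only: pull) simp
qed

lemma cubic_matrix_expansion:
  fixes A :: "'m::finite cubic_matrix"
  shows "A = (\<Sum>i\<in>UNIV. \<Sum>j\<in>UNIV. \<Sum>k\<in>UNIV. A $ i $ j $ k *\<^sub>R cubic_unit i j k)"
proof -
  have "(\<Sum>i\<in>UNIV. \<Sum>j\<in>UNIV. \<Sum>k\<in>UNIV. A $ i $ j $ k * cubic_unit i j k $ p $ q $ s) =
      A $ p $ q $ s" for p q s
  proof -
    have "A $ i $ j $ k * cubic_unit i j k $ p $ q $ s =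
        cubic_unit p q s $ i $ j $ k *\<^sub>R A $ i $ j $ k" for i j k
      by (auto simp: cubic_unit_nth)
    then show ?thesis
      by (simp only: sum_cubic_unit_scaleR[where h = "\<lambda>i j k. A $ i $ j $ k"])
  qed
  then show ?thesis
    by (simp add: vec_eq_iff)
qed

lemma bilinear_cubic_mult: "bilinear (cubic_mult a)"
  unfolding bilinear_def cubic_mult_def
  by (auto intro!: linearI simp: algebra_simps sum.distrib scaleR_sum_right)

lemma cubic_mult_unit:
  "cubic_mult a (cubic_unit i j k) (cubic_unit l n r) =
     (if k = l then cubic_unit i (a j n) r else 0)"
  unfolding cubic_mult_def
  by (simp only: scaleR_scaleR[symmetric] scaleR_sum_right[symmetric] sum_cubic_unit_scaleR)

lemma cubic_mult_unique:
  fixes g :: "'m::finite cubic_matrix \<Rightarrow> 'm cubic_matrix \<Rightarrow> 'm cubic_matrix"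
  assumes "bilinear g"
    and "\<And>i j k l n r. g (cubic_unit i j k) (cubic_unit l n r) =
           (if k = l then cubic_unit i (a j n) r else 0)"
  shows "g = cubic_mult a"
proof (intro ext)
  fix A B :: "'m cubic_matrix"
  have lin: "linear (\<lambda>x. g x y)" "linear (g x)" for x y
    using assms(1) by (auto simp: bilinear_def)
  have right: "g (cubic_unit i j k) B =
      (\<Sum>l\<in>UNIV. \<Sum>n\<in>UNIV. \<Sum>r\<in>UNIV. B $ l $ n $ r *\<^sub>R
        (if k = l then cubic_unit i (a j n) r else 0))" for i j k
  proof -
    have "g (cubic_unit i j k) B = g (cubic_unit i j k)
        (\<Sum>l\<in>UNIV. \<Sum>n\<in>UNIV. \<Sum>r\<in>UNIV. B $ l $ n $ r *\<^sub>R cubic_unit l n r)"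
      using cubic_matrix_expansion[of B] by simp
    then show ?thesis
      by (simp only: linear_sum[OF lin(2)] linear_scale[OF lin(2)] assms(2))
  qed
  have "g A B = g (\<Sum>i\<in>UNIV. \<Sum>j\<in>UNIV. \<Sum>k\<in>UNIV. A $ i $ j $ k *\<^sub>R cubic_unit i j k) B"
    using cubic_matrix_expansion[of A] by simp
  also have "\<dots> = (\<Sum>i\<in>UNIV. \<Sum>j\<in>UNIV. \<Sum>k\<in>UNIV. A $ i $ j $ k *\<^sub>R g (cubic_unit i j k) B)"
    by (simp only: linear_sum[OF lin(1)] linear_scale[OF lin(1)])
  also have "\<dots> = cubic_mult a A B"
    by (simp only: right cubic_mult_def scaleR_sum_right scaleR_scaleR)
  finally show "g A B = cubic_mult a A B" .
qed

end

theory Submission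
  imports Defs
begin

text \<open>
  A character \<open>\<chi>\<close> vanishes on every basis element. An off-diagonal element \<open>E\<^sub>i\<^sub>j\<^sub>k\<close>, \<open>i \<noteq> k\<close>, squares
  to zero, so its value squares to zero in \<open>\<real>\<close>. For a diagonal element, the square
  \<open>E\<^sub>i\<^sub>j\<^sub>i * E\<^sub>i\<^sub>j\<^sub>i\<close> equals the product \<open>E\<^sub>i\<^sub>j\<^sub>l * E\<^sub>l\<^sub>j\<^sub>i\<close> for every \<open>l\<close>; since there are at least two
  indices, \<open>l\<close> can be chosen different from \<open>i\<close>, and then \<open>\<chi>\<close> kills both factors. As the basis
  elements span, \<open>\<chi> = 0\<close>.
\<close>

lemma linear_eq_0_on_cubic_units:
  fixes f :: "'m::finite cubic_matrix \<Rightarrow> real"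
  assumes "linear f" and "\<And>i j k. f (cubic_unit i j k) = 0"
  shows "f A = 0"
proof -
  have "f A = f (\<Sum>i\<in>UNIV. \<Sum>j\<in>UNIV. \<Sum>k\<in>UNIV. A $ i $ j $ k *\<^sub>R cubic_unit i j k)"
    using cubic_matrix_expansion[of A] by simp
  also have "\<dots> = 0"
    by (simp add: linear_sum[OF assms(1)] linear_scale[OF assms(1)] assms(2))
  finally show ?thesis .
qed

theorem theorem4p1:
  fixes a :: "'m::finite \<Rightarrow> 'm \<Rightarrow> 'm"
  assumes "CARD('m) \<ge> 2"
    and "semigroup a"
  shows "\<not> baric (cubic_mult a)"
proof
  assume "baric (cubic_mult a)"
  then obtain f :: "'m cubic_matrix \<Rightarrow> real"
    where lin: "linear f" and mult: "\<And>A B. f (cubic_mult a A B) = f A * f B"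
      and nonzero: "f \<noteq> (\<lambda>A. 0)"
    unfolding baric_def algebra_character_def algebra_hom_def by blast
  have off_diagonal: "f (cubic_unit i j k) = 0" if "i \<noteq> k" for i j k
    using mult[of "cubic_unit i j k" "cubic_unit i j k"] that linear_0[OF lin]
    by (simp add: cubic_mult_unit)
  have diagonal: "f (cubic_unit i j i) = 0" for i j
  proof -
    have "UNIV \<noteq> {i}"
    proof
      assume "UNIV = {i}"
      then have "CARD('m) = card {i}" by (rule arg_cong)
      with assms(1) show False by simp
    qed
    then obtain l where "l \<noteq> i" by auto
    have "f (cubic_unit i j i) * f (cubic_unit i j i) = f (cubic_unit i (a j j) i)"
      using mult[of "cubic_unit i j i" "cubic_unit i j i"] by (simp add: cubic_mult_unit)
    also have "\<dots> = f (cubic_unit i j l) * f (cubic_unit l j i)"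
      using mult[of "cubic_unit i j l" "cubic_unit l j i"] by (simp add: cubic_mult_unit)
    also have "\<dots> = 0"
      using off_diagonal \<open>l \<noteq> i\<close> by simp
    finally show ?thesis by simp
  qed
  have "f (cubic_unit i j k) = 0" for i j k
    using off_diagonal diagonal by (cases "i = k") auto
  then have "f A = 0" for A
    by (rule linear_eq_0_on_cubic_units[OF lin])
  with nonzero show False by auto
qed

end
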